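(* Let $\emptyset\neq\mathcal{H}\subset\mathcal{F}(T)$ and let $(\mathrm{P})$ be bounded, i.e. $\alpha:=\inf(\mathrm{P})\in\mathbb{R}$. Consider the following assertions: (i) $(0_{X^*},-\alpha)\in\mathcal{A}_{\mathcal{H}}$. (ii) $\mathcal{H}$-strong duality holds, i.e. $\alpha=\max(\mathrm{D}_{\mathcal{H}})$. (iii) $(\mathrm{D})$ is $\mathcal{H}$-reducible and zero $\mathcal{H}$-duality holds, i.e. $\alpha=\sup(\mathrm{D}_{\mathcal{H}})$ (entailing $\alpha=\sup(\mathrm{D})$). (iv) $(\mathrm{P})$ is $\mathcal{H}$-reducible. Then (i) $\Longleftrightarrow$ (ii) $\Longrightarrow$ (iii) $\Longrightarrow$ (iv). Moreover, if the following assumption is satisfied: $(\mathrm{R}_{\mathcal{H}})$ for every $H\in\mathcal{H}$ such that $\inf(\mathrm{P}_H)\in\mathbb{R}$ one has $\inf(\mathrm{P}_H)=\max(\mathrm{D}_H)$, then (i), (ii), (iii) and (iv) are equivalent.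
   Context: $X$ is a locally convex Hausdorff (real) topological vector space with topological dual $X^*$; $0_{X^*}$ is the null element of $X^*$. $T$ is an infinite index set, $f$ and $f_t$ ($t\in T$) are convex proper functions $X\to\mathbb{R}\cup\{+\infty\}$, and $\mathcal{F}(T)$ is the family of all non-empty finite subsets of $T$. The convention $0\times(+\infty)=0$ is used. For $h:X\to\overline{\mathbb{R}}$, $h^*(x^* )=\sup_{x\in X}\{\langle x^*,x\rangle-h(x)\}$ is the Legendre–Fenchel conjugate and $\operatorname{epi}h^*=\{(x^*,r)\in X^*\times\mathbb{R}:h^*(x^* )\le r\}$. Problems (for $H\in\mathcal{F}(T)$), whose optimal values lie in $\overline{\mathbb{R}}$: - $(\mathrm{P})$: $\inf f(x)$ s.t. $f_t(x)\le 0$, $t\in T$. - $(\mathrm{P}_H)$: $\inf f(x)$ s.t. $f_t(x)\le 0$, $t\in H$. - $(\mathrm{D}_H)$: $\sup_{\mu\in\mathbb{R}_+^H}\inf_{x\in X}\{f(x)+\sum_{t\in H}\mu_tf_t(x)\}$. - $(\mathrm{D}_{\mathcal{H}})$: $\sup_{H\in\mathcal{H},\,\mu\in\mathbb{R}_+^H}\inf_{x\in X}\{f(x)+\sum_{t\in H}\mu_tf_t(x)\}$. - $(\mathrm{D})$ is $(\mathrm{D}_{\mathcal{F}(T)})$. Writing $\max$ instead of $\sup$ for a dual problem means that the supremum over the dual variables ($(H,\mu)$ for $(\mathrm{D}_{\mathcal{H}})$, $\mu$ for $(\mathrm{D}_H)$) is attained. $\mathcal{A}_{\mathcal{H}}:=\bigcup_{H\in\mathcal{H}}\bigcup_{\mu\in\mathbb{R}_+^H}\operatorname{epi}\left(f+\sum_{t\in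 H}\mu_tf_t\right)^*\subset X^*\times\mathbb{R}$. $(\mathrm{P})$ (resp. $(\mathrm{D})$) is $\mathcal{H}$-reducible if there exists $H\in\mathcal{H}$ such that $\inf(\mathrm{P})=\inf(\mathrm{P}_H)$ (resp. $\sup(\mathrm{D})=\sup(\mathrm{D}_H)$). *)

theory Defs
  imports "HOL-Analysis.Analysis"
begin

text \<open>In the last class axiom, convexity of \<open>V\<close> is written out as in \<open>convex_def\<close>, because the
  constant \<^const>\<open>convex\<close> cannot be used inside a class specification: it requires the class
  \<^class>\<open>real_vector\<close> of its type parameter.\<close>

class locally_convex_t2_space = real_vector + t2_space + topological_ab_group_add +
  assumes tendsto_scaleR_Pair:
      "filterlim (\<lambda>p. scaleR (fst p) (snd p)) (nhds (scaleR c a)) (nhds c \<times>\<^sub>F nhds a)"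
    and locally_convex_nhds:
      "open U \<Longrightarrow> a \<in> U \<Longrightarrow> \<exists>V. open V \<and>
         (\<forall>x\<in>V. \<forall>y\<in>V. \<forall>u\<ge>0. \<forall>v\<ge>0. u + v = 1 \<longrightarrow> scaleR u x + scaleR v y \<in> V) \<and> a \<in> V \<and> V \<subseteq> U"

instance real_normed_vector \<subseteq> locally_convex_t2_space
proof
  fix c :: real and a :: 'a
  show "filterlim (\<lambda>p. fst p *\<^sub>R snd p) (nhds (c *\<^sub>R a)) (nhds c \<times>\<^sub>F nhds a)"
    by (intro tendsto_scaleR filterlim_fst filterlim_snd)
next
  fix U :: "'a set" and a :: 'a
  assume "open U" "a \<in> U"
  then obtain e where "e > 0" "ball a e \<subseteq> U"
    using open_contains_ball by blast
  then show "\<exists>V. open V \<and>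
      (\<forall>x\<in>V. \<forall>y\<in>V. \<forall>u\<ge>0. \<forall>v\<ge>0. u + v = 1 \<longrightarrow> u *\<^sub>R x + v *\<^sub>R y \<in> V) \<and> a \<in> V \<and> V \<subseteq> U"
    using convex_ball[of a e] unfolding convex_def
    by (intro exI[of _ "ball a e"] conjI) simp_all
qed

definition topological_dual :: "('a::locally_convex_t2_space \<Rightarrow> real) set" where
  "topological_dual = {l. linear l \<and> continuous_on UNIV l}"

definition proper_fun :: "('a \<Rightarrow> ereal) \<Rightarrow> bool" where
  "proper_fun h \<longleftrightarrow> (\<forall>x. h x \<noteq> -\<infinity>) \<and> (\<exists>x. h x \<noteq> \<infinity>)"

text \<open>Multiplication on \<^typ>\<open>ereal\<close> satisfies the convention \<open>0 \<cdot> (+\<infinity>) = 0\<close>. The inequality below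
  is only used for functions that do not take the value \<open>-\<infinity>\<close>.\<close>

definition convex_fun :: "('a::real_vector \<Rightarrow> ereal) \<Rightarrow> bool" where
  "convex_fun h \<longleftrightarrow>
     (\<forall>x y. \<forall>u\<ge>0. \<forall>v\<ge>0. u + v = 1 \<longrightarrow> h (u *\<^sub>R x + v *\<^sub>R y) \<le> ereal u * h x + ereal v * h y)"

definition conjugate :: "('a::locally_convex_t2_space \<Rightarrow> ereal) \<Rightarrow> ('a \<Rightarrow> real) \<Rightarrow> ereal" where
  "conjugate h l = (SUP x. ereal (l x) - h x)"

definition epi_conjugate ::
    "('a::locally_convex_t2_space \<Rightarrow> ereal) \<Rightarrow> (('a \<Rightarrow> real) \<times> real) set" where
  "epi_conjugate h = {(l, r). l \<in> topological_dual \<and> conjugate h l \<le> ereal r}"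

definition finite_index_sets :: "'t set \<Rightarrow> 't set set" where
  "finite_index_sets T = {H. H \<subseteq> T \<and> finite H \<and> H \<noteq> {}}"

text \<open>The optimal value of \<open>(P)\<close> is obtained with \<open>S = T\<close>, that of \<open>(P\<^sub>H)\<close> with \<open>S = H\<close>.\<close>

definition primal_value :: "('a \<Rightarrow> ereal) \<Rightarrow> ('t \<Rightarrow> 'a \<Rightarrow> ereal) \<Rightarrow> 't set \<Rightarrow> ereal" where
  "primal_value f g S = (INF x\<in>{x. \<forall>t\<in>S. g t x \<le> 0}. f x)"

definition multipliers :: "'t set \<Rightarrow> ('t \<Rightarrow> real) set" where
  "multipliers H = H \<rightarrow>\<^sub>E {0..}"

definition lagrangian ::
    "('a \<Rightarrow> ereal) \<Rightarrow> ('t \<Rightarrow> 'a \<Rightarrow> ereal) \<Rightarrow> 't set \<Rightarrow> ('t \<Rightarrow> real) \<Rightarrow> 'a \<Rightarrow> ereal" where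
  "lagrangian f g H \<mu> x = f x + (\<Sum>t\<in>H. ereal (\<mu> t) * g t x)"

definition dual_objective ::
    "('a \<Rightarrow> ereal) \<Rightarrow> ('t \<Rightarrow> 'a \<Rightarrow> ereal) \<Rightarrow> 't set \<Rightarrow> ('t \<Rightarrow> real) \<Rightarrow> ereal" where
  "dual_objective f g H \<mu> = (INF x. lagrangian f g H \<mu> x)"

definition dual_value :: "('a \<Rightarrow> ereal) \<Rightarrow> ('t \<Rightarrow> 'a \<Rightarrow> ereal) \<Rightarrow> 't set \<Rightarrow> ereal" where
  "dual_value f g H = (SUP \<mu>\<in>multipliers H. dual_objective f g H \<mu>)"

definition dual_family_value ::
    "('a \<Rightarrow> ereal) \<Rightarrow> ('t \<Rightarrow> 'a \<Rightarrow> ereal) \<Rightarrow> 't set set \<Rightarrow> ereal" where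
  "dual_family_value f g \<H> = (SUP (H, \<mu>)\<in>Sigma \<H> multipliers. dual_objective f g H \<mu>)"

text \<open>\<open>is_dual_max f g H v\<close> and \<open>is_dual_family_max f g \<H> v\<close> say that \<open>v = max (D\<^sub>H)\<close> and
  \<open>v = max (D\<^sub>\<H>)\<close>: the value \<open>v\<close> is the supremum and it is attained.\<close>

definition is_dual_max ::
    "('a \<Rightarrow> ereal) \<Rightarrow> ('t \<Rightarrow> 'a \<Rightarrow> ereal) \<Rightarrow> 't set \<Rightarrow> ereal \<Rightarrow> bool" where
  "is_dual_max f g H v \<longleftrightarrow>
     v = dual_value f g H \<and> (\<exists>\<mu>\<in>multipliers H. dual_objective f g H \<mu> = v)"

definition is_dual_family_max ::
    "('a \<Rightarrow> ereal) \<Rightarrow> ('t \<Rightarrow> 'a \<Rightarrow> ereal) \<Rightarrow> 't set set \<Rightarrow> ereal \<Rightarrow> bool" where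
  "is_dual_family_max f g \<H> v \<longleftrightarrow>
     v = dual_family_value f g \<H> \<and>
     (\<exists>(H, \<mu>)\<in>Sigma \<H> multipliers. dual_objective f g H \<mu> = v)"

definition epi_family ::
    "('a::locally_convex_t2_space \<Rightarrow> ereal) \<Rightarrow> ('t \<Rightarrow> 'a \<Rightarrow> ereal) \<Rightarrow> 't set set \<Rightarrow>
      (('a \<Rightarrow> real) \<times> real) set" where
  "epi_family f g \<H> = (\<Union>H\<in>\<H>. \<Union>\<mu>\<in>multipliers H. epi_conjugate (lagrangian f g H \<mu>))"

definition primal_reducible ::
    "('a \<Rightarrow> ereal) \<Rightarrow> ('t \<Rightarrow> 'a \<Rightarrow> ereal) \<Rightarrow> 't set \<Rightarrow> 't set set \<Rightarrow> bool" where
  "primal_reducible f g T \<H> \<longleftrightarrow> (\<exists>H\<in>\<H>. primal_value f g T = primal_value f g H)"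

definition dual_reducible ::
    "('a \<Rightarrow> ereal) \<Rightarrow> ('t \<Rightarrow> 'a \<Rightarrow> ereal) \<Rightarrow> 't set \<Rightarrow> 't set set \<Rightarrow> bool" where
  "dual_reducible f g T \<H> \<longleftrightarrow>
     (\<exists>H\<in>\<H>. dual_family_value f g (finite_index_sets T) = dual_value f g H)"

definition finite_strong_duality ::
    "('a \<Rightarrow> ereal) \<Rightarrow> ('t \<Rightarrow> 'a \<Rightarrow> ereal) \<Rightarrow> 't set set \<Rightarrow> bool" where
  "finite_strong_duality f g \<H> \<longleftrightarrow>
     (\<forall>H\<in>\<H>. (\<exists>r::real. primal_value f g H = ereal r) \<longrightarrow>
        is_dual_max f g H (primal_value f g H))"

end

theory Submission
  imports Defs
begin

text \<open>Everything rests on weak duality: at a point feasible for \<open>(P\<^sub>H)\<close> the penalty terms of the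
  Lagrangian are nonpositive, so every dual objective with multipliers on \<open>H\<close> is at most
  \<open>inf (P\<^sub>H)\<close>, hence at most \<open>\<alpha>\<close>, because \<open>(P)\<close> has all the constraints of \<open>(P\<^sub>H)\<close>. Thus all the
  values concerned are squeezed below \<open>\<alpha>\<close>, and each implication only needs some lower bound \<open>\<alpha>\<close>.

  The conjugate at the null functional is minus the infimum. So \<open>(0, -\<alpha>)\<close> lies in the epigraph
  of \<open>(f + \<Sum>\<^bsub>t\<in>H\<^esub> \<mu>\<^sub>t f\<^sub>t)\<^sup>*\<close> exactly when the dual objective at \<open>(H, \<mu>)\<close> is at least \<open>\<alpha>\<close>, and by
  weak duality such a pair is an optimal solution of the family dual with value \<open>\<alpha>\<close>: this is
  (i) \<open>\<longleftrightarrow>\<close> (ii). The set \<open>H\<close> of that solution reduces \<open>(D)\<close>, which gives (iii), and a set \<open>H\<close> that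
  reduces \<open>(D)\<close> also reduces \<open>(P)\<close>, since
  \<open>\<alpha> = sup (D) = sup (D\<^sub>H) \<le> inf (P\<^sub>H) \<le> inf (P) = \<alpha>\<close>. Under the additional assumption, a set \<open>H\<close>
  with \<open>inf (P\<^sub>H) = \<alpha>\<close> carries multipliers with dual objective \<open>\<alpha>\<close>, which closes the circle.\<close>
lemma primal_value_mono:
  assumes "S \<subseteq> S'"
  shows "primal_value f g S \<le> primal_value f g S'"
  unfolding primal_value_def using assms by (intro INF_superset_mono) auto

lemma lagrangian_le_objective:
  assumes "\<mu> \<in> multipliers H" and "\<forall>t\<in>H. g t x \<le> 0"
  shows "lagrangian f g H \<mu> x \<le> f x"
proof -
  have "(\<Sum>t\<in>H. ereal (\<mu> t) * g t x) \<le> 0"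
  proof (rule sum_nonpos)
    fix t assume "t \<in> H"
    with assms have "0 \<le> \<mu> t" and "g t x \<le> 0"
      by (auto simp: multipliers_def)
    then show "ereal (\<mu> t) * g t x \<le> 0"
      using ereal_mult_left_mono[of "g t x" 0 "ereal (\<mu> t)"] by simp
  qed
  from add_left_mono[OF this, of "f x"] show ?thesis
    by (simp add: lagrangian_def)
qed

lemma weak_duality:
  assumes "\<mu> \<in> multipliers H"
  shows "dual_objective f g H \<mu> \<le> primal_value f g H"
  unfolding primal_value_def
proof (rule INF_greatest)
  fix x assume "x \<in> {x. \<forall>t\<in>H. g t x \<le> 0}"
  then have "lagrangian f g H \<mu> x \<le> f x"
    using assms by (simp add: lagrangian_le_objective)
  then show "dual_objective f g H \<mu> \<le> f x"
    unfolding dual_objective_def by (rule INF_lower2[OF UNIV_I])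
qed

lemma dual_value_le_primal_value: "dual_value f g H \<le> primal_value f g H"
  unfolding dual_value_def by (intro SUP_least weak_duality)

lemma dual_objective_le_dual_value:
  "\<mu> \<in> multipliers H \<Longrightarrow> dual_objective f g H \<mu> \<le> dual_value f g H"
  unfolding dual_value_def by (rule SUP_upper)

lemma dual_family_value_eq_SUP: "dual_family_value f g \<H> = (SUP H\<in>\<H>. dual_value f g H)"
  unfolding dual_family_value_def dual_value_def Sigma_def SUP_UNION by simp

lemma dual_value_le_dual_family_value:
  "H \<in> \<H> \<Longrightarrow> dual_value f g H \<le> dual_family_value f g \<H>"
  unfolding dual_family_value_eq_SUP by (rule SUP_upper)

lemma dual_family_value_mono:
  "\<H> \<subseteq> \<K> \<Longrightarrow> dual_family_value f g \<H> \<le> dual_family_value f g \<K>"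
  unfolding dual_family_value_eq_SUP by (rule SUP_subset_mono) auto

lemma dual_family_value_le_primal_value:
  assumes "\<And>H. H \<in> \<H> \<Longrightarrow> H \<subseteq> T"
  shows "dual_family_value f g \<H> \<le> primal_value f g T"
  unfolding dual_family_value_eq_SUP
proof (rule SUP_least)
  fix H assume "H \<in> \<H>"
  then have "primal_value f g H \<le> primal_value f g T"
    by (intro primal_value_mono assms)
  with dual_value_le_primal_value show "dual_value f g H \<le> primal_value f g T"
    by (rule order_trans)
qed

lemma conjugate_null: "conjugate h (\<lambda>_. 0) = - (INF x. h x)"
  unfolding conjugate_def by (simp add: zero_ereal_def[symmetric] ereal_SUP_uminus_eq)

lemma null_mem_topological_dual: "(\<lambda>_. 0) \<in> topological_dual"
  by (simp add: topological_dual_def linear_iff)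

text \<open>The conjugate at the null functional is minus the dual objective, and negation reverses the
  inequality that defines the epigraph.\<close>
lemma null_mem_epi_family_iff:
  "((\<lambda>_. 0, - \<alpha>) \<in> epi_family f g \<H>) \<longleftrightarrow>
     (\<exists>H\<in>\<H>. \<exists>\<mu>\<in>multipliers H. ereal \<alpha> \<le> dual_objective f g H \<mu>)"
proof -
  have "- m \<le> ereal (- \<alpha>) \<longleftrightarrow> ereal \<alpha> \<le> m" for m
    using ereal_minus_le_minus[of m "ereal \<alpha>"] by simp
  then show ?thesis
    by (simp add: epi_family_def epi_conjugate_def null_mem_topological_dual conjugate_null
        dual_objective_def)
qed

text \<open>Each dual objective is at most the family dual value, hence at most \<open>v\<close>, so one that is at
  least \<open>v\<close> forces equality throughout. Weak duality provides the bound for \<open>v = \<alpha>\<close>, and the right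
  side is then the same existence statement as in \<open>null_mem_epi_family_iff\<close>.\<close>
lemma is_dual_family_max_iff:
  assumes "dual_family_value f g \<H> \<le> v"
  shows "is_dual_family_max f g \<H> v \<longleftrightarrow>
     (\<exists>H\<in>\<H>. \<exists>\<mu>\<in>multipliers H. v \<le> dual_objective f g H \<mu>)"
proof
  assume "is_dual_family_max f g \<H> v"
  then obtain H \<mu> where "H \<in> \<H>" and "\<mu> \<in> multipliers H" and "dual_objective f g H \<mu> = v"
    unfolding is_dual_family_max_def by blast
  then show "\<exists>H\<in>\<H>. \<exists>\<mu>\<in>multipliers H. v \<le> dual_objective f g H \<mu>"
    by (metis order_refl)
next
  assume "\<exists>H\<in>\<H>. \<exists>\<mu>\<in>multipliers H. v \<le> dual_objective f g H \<mu>"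
  then obtain H \<mu> where H: "H \<in> \<H>" and \<mu>: "\<mu> \<in> multipliers H"
    and le: "v \<le> dual_objective f g H \<mu>" by blast
  have "dual_objective f g H \<mu> \<le> dual_family_value f g \<H>"
    using dual_objective_le_dual_value[OF \<mu>] dual_value_le_dual_family_value[OF H]
    by (rule order_trans)
  with le assms have "v = dual_family_value f g \<H>" and "dual_objective f g H \<mu> = v"
    by auto
  with H \<mu> show "is_dual_family_max f g \<H> v"
    unfolding is_dual_family_max_def by blast
qed

theorem theorem3p1:
  fixes f :: "'a::locally_convex_t2_space \<Rightarrow> ereal"
    and g :: "'t \<Rightarrow> 'a \<Rightarrow> ereal"
    and T :: "'t set"
    and \<H> :: "'t set set"
    and \<alpha> :: real
  assumes "infinite T"
    and "proper_fun f" and "convex_fun f"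
    and "\<forall>t\<in>T. proper_fun (g t) \<and> convex_fun (g t)"
    and "\<H> \<noteq> {}" and "\<H> \<subseteq> finite_index_sets T"
    and "primal_value f g T = ereal \<alpha>"
  shows "let i = ((\<lambda>_. 0, - \<alpha>) \<in> epi_family f g \<H>);
             ii = is_dual_family_max f g \<H> (ereal \<alpha>);
             iii = (dual_reducible f g T \<H> \<and> ereal \<alpha> = dual_family_value f g \<H>);
             iv = primal_reducible f g T \<H>
         in (i \<longleftrightarrow> ii) \<and> (ii \<longrightarrow> iii) \<and> (iii \<longrightarrow> iv) \<and>
            (iii \<longrightarrow> ereal \<alpha> = dual_family_value f g (finite_index_sets T)) \<and>
            (finite_strong_duality f g \<H> \<longrightarrow>
               (i \<longleftrightarrow> ii) \<and> (ii \<longleftrightarrow> iii) \<and> (iii \<longleftrightarrow> iv))"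
proof -
  have sub: "H \<subseteq> T" if "H \<in> finite_index_sets T" for H
    using that by (simp add: finite_index_sets_def)
  have D_le: "dual_family_value f g (finite_index_sets T) \<le> ereal \<alpha>"
    using dual_family_value_le_primal_value[of "finite_index_sets T" T f g] sub assms(7) by simp
  have DH_le_D: "dual_family_value f g \<H> \<le> dual_family_value f g (finite_index_sets T)"
    using assms(6) by (rule dual_family_value_mono)
  have DH_le: "dual_family_value f g \<H> \<le> ereal \<alpha>"
    using DH_le_D D_le by (rule order_trans)
  note ii_iff = is_dual_family_max_iff[OF DH_le]
  have i_ii: "((\<lambda>_. 0, - \<alpha>) \<in> epi_family f g \<H>) \<longleftrightarrow> is_dual_family_max f g \<H> (ereal \<alpha>)"
    by (simp add: null_mem_epi_family_iff ii_iff)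
  have zero_D: "ereal \<alpha> = dual_family_value f g (finite_index_sets T)"
    if "ereal \<alpha> = dual_family_value f g \<H>"
    using that DH_le_D D_le by simp
  have ii_iii: "dual_reducible f g T \<H> \<and> ereal \<alpha> = dual_family_value f g \<H>"
    if ii: "is_dual_family_max f g \<H> (ereal \<alpha>)"
  proof
    show eq: "ereal \<alpha> = dual_family_value f g \<H>"
      using ii by (simp add: is_dual_family_max_def)
    obtain H \<mu> where H: "H \<in> \<H>" and "\<mu> \<in> multipliers H"
      and "ereal \<alpha> \<le> dual_objective f g H \<mu>"
      using ii ii_iff by blast
    then have "ereal \<alpha> \<le> dual_value f g H"
      by (blast intro: order_trans dual_objective_le_dual_value)
    moreover have "dual_value f g H \<le> ereal \<alpha>"
      using dual_value_le_dual_family_value[OF H] DH_le by (rule order_trans)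
    ultimately have "dual_family_value f g (finite_index_sets T) = dual_value f g H"
      using zero_D[OF eq] by simp
    with H show "dual_reducible f g T \<H>"
      unfolding dual_reducible_def by blast
  qed
  have iii_iv: "primal_reducible f g T \<H>"
    if red: "dual_reducible f g T \<H>" and eq: "ereal \<alpha> = dual_family_value f g \<H>"
  proof -
    obtain H where H: "H \<in> \<H>"
      and "dual_family_value f g (finite_index_sets T) = dual_value f g H"
      using red unfolding dual_reducible_def by blast
    then have "primal_value f g T \<le> primal_value f g H"
      using zero_D[OF eq] assms(7) dual_value_le_primal_value[of f g H] by simp
    moreover have "primal_value f g H \<le> primal_value f g T"
      using H assms(6) sub by (intro primal_value_mono) blast
    ultimately show ?thesis
      unfolding primal_reducible_def using H by (blast intro: order_antisym)
  qed
  have iv_ii: "is_dual_family_max f g \<H> (ereal \<alpha>)"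
    if R: "finite_strong_duality f g \<H>" and iv: "primal_reducible f g T \<H>"
  proof -
    obtain H where H: "H \<in> \<H>" and val: "primal_value f g H = ereal \<alpha>"
      using iv assms(7) unfolding primal_reducible_def by auto
    then have "is_dual_max f g H (ereal \<alpha>)"
      using R unfolding finite_strong_duality_def by metis
    then obtain \<mu> where "\<mu> \<in> multipliers H" and "dual_objective f g H \<mu> = ereal \<alpha>"
      unfolding is_dual_max_def by blast
    with H show ?thesis
      unfolding ii_iff by (metis order_refl)
  qed
  show ?thesis
    unfolding Let_def using i_ii zero_D ii_iii iii_iv iv_ii by blast
qed

end
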